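(* Let $(S,+,\cdot)$ be a (right distributive) seminearring. Then the following statements are equivalent: (1) $S$ is generalized left completely regular (GLCR) as well as multiplicatively completely regular. (2) Every $\mathcal{H}^+$-class of $S$ is a completely regular near-ring. (3) $S$ is a (disjoint) union of completely regular near-rings.
   Context: A seminearring $(S,+,\cdot)$ is a set with two operations such that $(S,+)$ and $(S,\cdot)$ are semigroups and multiplication is distributive over addition from the right: $(x+y)z=xz+yz$ for all $x,y,z\in S$. Addition is not assumed commutative. A near-ring is a seminearring $(N,+,\cdot)$ (right distributive) such that $(N,+)$ is a group, not necessarily abelian. A semigroup is completely regular if for each element $a$ there is $x$ with $axa=a$ and $ax=xa$. A seminearring $S$ is multiplicatively completely regular if $(S,\cdot)$ is a completely regular semigroup; a completely regular near-ring is a near-ring whose multiplicative semigroup is completely regular. $\mathcal{H}^+$ denotes Green's relation $\mathcal{H}$ on the additive semigroup $(S,+)$. A seminearring is additively completely regular if $(S,+)$ is a completely regular semigroup, i.e. for each $a\in S$ there is $x\in S$ with $a+x+a=a$ and $a+x=x+a$. An additively completely regular seminearring $S$ is generalized left completely regular (GLCR) if for each $a\in S$ there exists $x_a\in S$ such that $a+x_a+a=a$, $a+x_a=x_a+a$ and $(a+x_a)a=a+x_a$. "Every $\mathcal{H}^+$-class is a near-ring (of a given type)" means each $\mathcal{H}^+$-class is closed under $+$ and $\cdot$ and is a near-ring (of that type) under the restricted operations. "$S$ is a (disjoint) union of near-rings of a given type" means $S$ is the union of a family of pairwise disjoint subsets, each closed under $+$ and $\cdot$ and each a near-ring of that type under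 the restricted operations. *)

theory Defs
  imports "HOL-Algebra.Group" "HOL-Library.Disjoint_Sets"
begin

locale semigroup_on =
  fixes S :: "'a set" and f :: "'a \<Rightarrow> 'a \<Rightarrow> 'a"
  assumes closed: "x \<in> S \<Longrightarrow> y \<in> S \<Longrightarrow> f x y \<in> S"
    and assoc: "x \<in> S \<Longrightarrow> y \<in> S \<Longrightarrow> z \<in> S \<Longrightarrow> f (f x y) z = f x (f y z)"

definition completely_regular_on :: "'a set \<Rightarrow> ('a \<Rightarrow> 'a \<Rightarrow> 'a) \<Rightarrow> bool" where
  "completely_regular_on S f \<longleftrightarrow>
     semigroup_on S f \<and> (\<forall>a\<in>S. \<exists>x\<in>S. f (f a x) a = a \<and> f a x = f x a)"

text \<open>Principal left and right ideals \<open>S\<^sup>1 a\<close> and \<open>a S\<^sup>1\<close>; inserting \<open>a\<close> accounts for the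
  adjoined identity.\<close>

definition left_ideal_of :: "'a set \<Rightarrow> ('a \<Rightarrow> 'a \<Rightarrow> 'a) \<Rightarrow> 'a \<Rightarrow> 'a set" where
  "left_ideal_of S f a = insert a ((\<lambda>s. f s a) ` S)"

definition right_ideal_of :: "'a set \<Rightarrow> ('a \<Rightarrow> 'a \<Rightarrow> 'a) \<Rightarrow> 'a \<Rightarrow> 'a set" where
  "right_ideal_of S f a = insert a ((\<lambda>s. f a s) ` S)"

definition green_L :: "'a set \<Rightarrow> ('a \<Rightarrow> 'a \<Rightarrow> 'a) \<Rightarrow> 'a rel" where
  "green_L S f = {(a, b). a \<in> S \<and> b \<in> S \<and> left_ideal_of S f a = left_ideal_of S f b}"

definition green_R :: "'a set \<Rightarrow> ('a \<Rightarrow> 'a \<Rightarrow> 'a) \<Rightarrow> 'a rel" where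
  "green_R S f = {(a, b). a \<in> S \<and> b \<in> S \<and> right_ideal_of S f a = right_ideal_of S f b}"

definition green_H :: "'a set \<Rightarrow> ('a \<Rightarrow> 'a \<Rightarrow> 'a) \<Rightarrow> 'a rel" where
  "green_H S f = green_L S f \<inter> green_R S f"

locale seminearring =
  plus: semigroup_on S add + times: semigroup_on S mul
  for S :: "'a set" and add :: "'a \<Rightarrow> 'a \<Rightarrow> 'a" and mul :: "'a \<Rightarrow> 'a \<Rightarrow> 'a" +
  assumes right_distrib:
    "x \<in> S \<Longrightarrow> y \<in> S \<Longrightarrow> z \<in> S \<Longrightarrow> mul (add x y) z = add (mul x z) (mul y z)"

text \<open>Since \<open>seminearring N add mul\<close> includes closure of \<open>N\<close>, for a subset \<open>N\<close> of a larger
  seminearring the following says that \<open>N\<close> is closed under both operations and is a near-ring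
  under their restrictions.\<close>

definition near_ring :: "'a set \<Rightarrow> ('a \<Rightarrow> 'a \<Rightarrow> 'a) \<Rightarrow> ('a \<Rightarrow> 'a \<Rightarrow> 'a) \<Rightarrow> bool" where
  "near_ring N add mul \<longleftrightarrow>
     seminearring N add mul \<and> (\<exists>z. group \<lparr>carrier = N, mult = add, one = z\<rparr>)"

definition completely_regular_near_ring ::
    "'a set \<Rightarrow> ('a \<Rightarrow> 'a \<Rightarrow> 'a) \<Rightarrow> ('a \<Rightarrow> 'a \<Rightarrow> 'a) \<Rightarrow> bool" where
  "completely_regular_near_ring N add mul \<longleftrightarrow>
     near_ring N add mul \<and> completely_regular_on N mul"

definition GLCR :: "'a set \<Rightarrow> ('a \<Rightarrow> 'a \<Rightarrow> 'a) \<Rightarrow> ('a \<Rightarrow> 'a \<Rightarrow> 'a) \<Rightarrow> bool" where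
  "GLCR S add mul \<longleftrightarrow>
     seminearring S add mul \<and> completely_regular_on S add \<and>
     (\<forall>a\<in>S. \<exists>x\<in>S. add (add a x) a = a \<and> add a x = add x a \<and> mul (add a x) a = add a x)"

end

theory Submission
  imports Defs
begin

text \<open>
  In an additively completely regular seminearring every \<open>\<H>\<^sup>+\<close>-class is an additive group, whose
  identity is \<open>a + x\<close> for any commuting quasi-inverse \<open>x\<close> of a member \<open>a\<close>. Right multiplications
  are additive endomorphisms, hence preserve \<open>\<H>\<^sup>+\<close>. If \<open>b\<close>, \<open>c\<close> lie in a class with identity \<open>e\<close>,
  then \<open>b c\<close> is \<open>\<H>\<^sup>+\<close>-related to \<open>e c\<close>, and the GLCR condition says \<open>e c = e\<close>; so classes are
  closed under multiplication. If \<open>y\<close> is the multiplicative inverse of \<open>a\<close> commuting with \<open>a\<close>,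
  multiplying \<open>a \<H>\<^sup>+ a\<^sup>2\<close> by \<open>y\<close> gives \<open>a y \<H>\<^sup>+ a\<close>, and multiplying by \<open>y\<close> again gives
  \<open>y \<H>\<^sup>+ a y\<close>, so \<open>y\<close> lies in the class of \<open>a\<close>. Conversely, \<open>0 a = 0\<close> in every near-ring, which
  yields the GLCR condition for unions of near-rings.
\<close>

section \<open>Green's relation H in an arbitrary semigroup\<close>

context semigroup_on
begin

lemma left_ideal_of_eq_iff:
  assumes "a \<in> S" "b \<in> S"
  shows "left_ideal_of S f a = left_ideal_of S f b \<longleftrightarrow>
    a \<in> left_ideal_of S f b \<and> b \<in> left_ideal_of S f a"
proof -
  have sub: "left_ideal_of S f x \<subseteq> left_ideal_of S f y"
    if "x \<in> left_ideal_of S f y" "y \<in> S" for x y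
    using that by (auto simp: left_ideal_of_def assoc[symmetric] closed)
  show ?thesis
    using sub assms by (metis insertI1 left_ideal_of_def subset_antisym)
qed

lemma right_ideal_of_eq_iff:
  assumes "a \<in> S" "b \<in> S"
  shows "right_ideal_of S f a = right_ideal_of S f b \<longleftrightarrow>
    a \<in> right_ideal_of S f b \<and> b \<in> right_ideal_of S f a"
proof -
  have sub: "right_ideal_of S f x \<subseteq> right_ideal_of S f y"
    if "x \<in> right_ideal_of S f y" "y \<in> S" for x y
    using that by (auto simp: right_ideal_of_def assoc closed)
  show ?thesis
    using sub assms by (metis insertI1 right_ideal_of_def subset_antisym)
qed

lemma green_H_iff:
  "(a, b) \<in> green_H S f \<longleftrightarrow> a \<in> S \<and> b \<in> S \<and>
     a \<in> left_ideal_of S f b \<and> b \<in> left_ideal_of S f a \<and>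
     a \<in> right_ideal_of S f b \<and> b \<in> right_ideal_of S f a"
  using left_ideal_of_eq_iff[of a b] right_ideal_of_eq_iff[of a b]
  unfolding green_H_def green_L_def green_R_def by blast

lemma equiv_green_H: "equiv S (green_H S f)"
  by (rule equivI)
    (auto simp: green_H_def green_L_def green_R_def refl_on_def sym_def trans_def)

text \<open>A witness \<open>s\<close> for \<open>x = f s y\<close> is carried to the witness
  \<open>h s\<close>. The intended \<open>h\<close> is right multiplication in a
  seminearring.\<close>

lemma green_H_endomorphism:
  assumes "(a, b) \<in> green_H S f"
    and "\<And>x. x \<in> S \<Longrightarrow> h x \<in> S"
    and "\<And>x y. x \<in> S \<Longrightarrow> y \<in> S \<Longrightarrow> h (f x y) = f (h x) (h y)"
  shows "(h a, h b) \<in> green_H S f"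
proof -
  have "h x \<in> left_ideal_of S f (h y)" if "x \<in> left_ideal_of S f y" "y \<in> S" for x y
    using that assms(2,3) by (auto simp: left_ideal_of_def)
  moreover have "h x \<in> right_ideal_of S f (h y)" if "x \<in> right_ideal_of S f y" "y \<in> S" for x y
    using that assms(2,3) by (auto simp: right_ideal_of_def)
  ultimately show ?thesis
    using assms(1,2) unfolding green_H_iff by blast
qed

lemma green_H_commuting_quasi_inverse:
  assumes "a \<in> S" "x \<in> S" "f (f a x) a = a" "f a x = f x a"
  shows "(f a x, a) \<in> green_H S f" "f (f a x) (f a x) = f a x"
proof -
  have "f a (f a x) = a"
    using assms by (metis assoc)
  then show "(f a x, a) \<in> green_H S f"
    unfolding green_H_iff left_ideal_of_def right_ideal_of_def
    using assms closed by (metis imageI insert_iff)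
  show "f (f a x) (f a x) = f a x"
    using assms closed by (metis assoc)
qed

context
  fixes e
  assumes e_in: "e \<in> S" and idem: "f e e = e"
begin

text \<open>Here \<open>b\<close> lies in both principal ideals of \<open>e\<close>, and an
  idempotent fixes its right multiples from the left and its left multiples from the right.\<close>

lemma idempotent_neutral_on_H_class:
  assumes "(e, b) \<in> green_H S f"
  shows "f e b = b" "f b e = b"
proof -
  have "b \<in> left_ideal_of S f e" "b \<in> right_ideal_of S f e"
    using assms by (auto simp: green_H_iff)
  moreover have "f (f t e) e = f t e" "f e (f e t) = f e t" if "t \<in> S" for t
    using that e_in idem assoc[of t e e] assoc[of e e t] by simp_all
  ultimately show "f e b = b" "f b e = b"
    unfolding left_ideal_of_def right_ideal_of_def using idem by fastforce+
qed

lemma green_H_idempotentE: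
  assumes "(e, b) \<in> green_H S f"
  obtains s t where "s \<in> S" "t \<in> S" "f b s = e" "f t b = e"
proof -
  have "e \<in> left_ideal_of S f b" "e \<in> right_ideal_of S f b" "b \<in> S"
    using assms by (auto simp: green_H_iff)
  \<comment> \<open>In the \<open>insert\<close> case \<open>e = b\<close>, the witness is
    \<open>e\<close> itself by idempotence.\<close>
  then have "\<exists>t\<in>S. f t b = e" "\<exists>s\<in>S. f b s = e"
    unfolding left_ideal_of_def right_ideal_of_def using e_in idem by auto
  then show thesis
    using that by blast
qed

lemma green_H_idempotentI:
  assumes "b \<in> S" "f e b = b" "f b e = b" "s \<in> S" "t \<in> S" "f b s = e" "f t b = e"
  shows "(e, b) \<in> green_H S f"
  unfolding green_H_iff left_ideal_of_def right_ideal_of_def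
  using assms e_in by (metis imageI insert_iff)

lemma idempotent_H_class_closed:
  assumes b: "(e, b) \<in> green_H S f" and c: "(e, c) \<in> green_H S f"
  shows "(e, f b c) \<in> green_H S f"
proof -
  have S: "b \<in> S" "c \<in> S"
    using b c by (auto simp: green_H_iff)
  obtain s t where st: "s \<in> S" "t \<in> S" "f b s = e" "f t b = e"
    using green_H_idempotentE[OF b] .
  obtain u v where uv: "u \<in> S" "v \<in> S" "f c u = e" "f v c = e"
    using green_H_idempotentE[OF c] .
  note neutral = idempotent_neutral_on_H_class[OF b] idempotent_neutral_on_H_class[OF c]
  show ?thesis
  proof (rule green_H_idempotentI[where s = "f u s" and t = "f v t"])
    show "f e (f b c) = f b c" "f (f b c) e = f b c"
      using S e_in neutral assoc by metis+
    have "f (f b c) (f u s) = f (f b (f c u)) s"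
      using S st(1) uv(1) by (simp only: assoc closed)
    then show "f (f b c) (f u s) = e"
      using st uv neutral by simp
    have "f (f v t) (f b c) = f v (f (f t b) c)"
      using S st(2) uv(2) by (simp only: assoc closed)
    then show "f (f v t) (f b c) = e"
      using st uv neutral by simp
  qed (use S st uv closed in auto)
qed

text \<open>The quotients \<open>s\<close> and \<open>t\<close> of \<open>e\<close> by
  \<open>b\<close> may lie outside the class; multiplying by \<open>e\<close> makes them coincide
  and moves them into it.\<close>

lemma idempotent_H_class_inverse:
  assumes b: "(e, b) \<in> green_H S f"
  obtains c where "(e, c) \<in> green_H S f" "f c b = e"
proof -
  have S: "b \<in> S"
    using b by (auto simp: green_H_iff)
  obtain s t where st: "s \<in> S" "t \<in> S" "f b s = e" "f t b = e"
    using green_H_idempotentE[OF b] .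
  note neutral = idempotent_neutral_on_H_class[OF b]
  \<comment> \<open>Both sides are bracketings of \<open>t b s\<close>.\<close>
  have eq: "f t e = f e s"
    using assoc[of t b s] S st by simp
  have r: "f b (f e s) = e"
    using assoc[of b e s] S st e_in neutral by simp
  have l: "f (f e s) b = e"
    using assoc[of t e b] S st e_in neutral eq by simp
  have "f e (f e s) = f e s"
    using assoc[of e e s] st e_in idem by simp
  moreover have "f (f e s) e = f e s"
    using assoc[of t e e] st e_in idem eq by simp
  ultimately have "(e, f e s) \<in> green_H S f"
    using green_H_idempotentI S st e_in r l closed by metis
  then show thesis
    using that l by blast
qed

text \<open>This is the maximal subgroup at \<open>e\<close>.\<close>

lemma idempotent_H_class_group:
  "group \<lparr>carrier = green_H S f `` {e}, mult = f, one = e\<rparr>"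
proof (rule groupI, goal_cases)
  case (3 x y z)
  then show ?case
    using assoc by (auto simp: green_H_iff)
next
  case (5 x)
  then show ?case
    using idempotent_H_class_inverse by auto
qed (use idempotent_H_class_closed idempotent_neutral_on_H_class
    equiv_class_self[OF equiv_green_H e_in] in auto)

end

text \<open>The third equation amounts to \<open>y a y = y\<close>; it later allows passing from the
  class of \<open>a y\<close> to \<open>y\<close> itself.\<close>

lemma commuting_inverseE:
  assumes "completely_regular_on S f" "a \<in> S"
  obtains y where "y \<in> S" "f (f a y) a = a" "f (f a y) y = y" "f a y = f y a"
proof -
  obtain x where x: "x \<in> S" "f (f a x) a = a" "f a x = f x a"
    using assms unfolding completely_regular_on_def by blast
  \<comment> \<open>The factor \<open>a x\<close> is idempotent, so \<open>y\<close> keeps the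
    products with \<open>a\<close> and absorbs \<open>a x\<close> on the left.\<close>
  define y where "y = f (f a x) x"
  have y: "y \<in> S"
    using x assms closed by (simp add: y_def)
  have ay: "f a y = f a x"
    unfolding y_def using x assms closed by (metis assoc)
  have ya: "f y a = f a x"
    unfolding y_def using x assms closed by (metis assoc)
  have "f (f a x) y = y"
    unfolding y_def using x assms closed
    by (metis assoc green_H_commuting_quasi_inverse(2))
  then show thesis
    using that[of y] x y ay ya by simp
qed

end

section \<open>From GLCR to near-rings on the additive H-classes\<close>

lemma (in seminearring) green_H_mul_right:
  assumes "(a, b) \<in> green_H S add" "c \<in> S"
  shows "(mul a c, mul b c) \<in> green_H S add"
  using plus.green_H_endomorphism[OF assms(1), of "\<lambda>x. mul x c"] assms(2)
  by (simp add: times.closed right_distrib)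

lemma GLCR_imp_H_class_completely_regular_near_ring:
  assumes "GLCR S add mul" "completely_regular_on S mul" "H \<in> S // green_H S add"
  shows "completely_regular_near_ring H add mul"
proof -
  interpret seminearring S add mul
    using assms(1) by (simp add: GLCR_def)
  let ?G = "green_H S add"
  note equiv = plus.equiv_green_H
  obtain a where a: "a \<in> S" "H = ?G `` {a}"
    using assms(3) by (auto elim: quotientE)
  obtain x where x: "x \<in> S" "add (add a x) a = a" "add a x = add x a"
    using assms(1) a unfolding GLCR_def by blast
  define e where "e = add a x"
  have e: "e \<in> S" "add e e = e" "(e, a) \<in> ?G"
    using plus.green_H_commuting_quasi_inverse[OF a(1) x] a x plus.closed by (auto simp: e_def)
  have H: "H = ?G `` {e}"
    using equiv_class_eq[OF equiv e(3)] a by simp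
  have HS: "c \<in> S" if "c \<in> H" for c
    using that by (auto simp: H plus.green_H_iff)
  have related: "(b, c) \<in> ?G" if "b \<in> H" "c \<in> H" for b c
    using that equiv unfolding H by (metis Image_singleton_iff equivE symD transD)
  have memI: "c \<in> H" if "(b, c) \<in> ?G" "b \<in> H" for b c
    using that equiv unfolding H by (metis Image_singleton_iff equivE transD)
  have eH: "e \<in> H"
    using equiv_class_self[OF equiv e(1)] H by simp
  have G: "group \<lparr>carrier = H, mult = add, one = e\<rparr>"
    unfolding H by (rule plus.idempotent_H_class_group[OF e(1,2)])
  have ec: "mul e c = e" if c: "c \<in> H" for c
  proof -
    obtain x where x: "x \<in> S" "add (add c x) c = c" "add c x = add x c"
      "mul (add c x) c = add c x"
      using assms(1) HS[OF c] unfolding GLCR_def by blast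
    note q = plus.green_H_commuting_quasi_inverse[OF HS[OF c] x(1-3)]
    have sym: "(c, add c x) \<in> ?G"
      using q(1) equiv by (metis equivE symD)
    have "add c x \<in> H"
      using memI[OF sym c] .
    \<comment> \<open>Two idempotents in one H-class coincide: each is neutral for the other, so
      \<open>add (add c x) e\<close> equals both.\<close>
    moreover have "e = add c x"
      using plus.idempotent_neutral_on_H_class(2)[OF e(1,2), of "add c x"]
        plus.idempotent_neutral_on_H_class(1)[OF HS q(2), of e]
        related[OF _ eH] related[OF eH] calculation by simp
    ultimately show ?thesis
      using x(4) by simp
  qed
  have mul_H: "mul b c \<in> H" if "b \<in> H" "c \<in> H" for b c
    using green_H_mul_right[OF related[OF eH that(1)] HS[OF that(2)]] ec[OF that(2)] memI eH
    by simp
  have add_H: "add b c \<in> H" if "b \<in> H" "c \<in> H" for b c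
    using plus.idempotent_H_class_closed[OF e(1,2)] that by (simp add: H)
  have snr: "seminearring H add mul"
    by unfold_locales
      (auto simp: add_H mul_H HS plus.assoc times.assoc right_distrib)
  have "\<exists>y\<in>H. mul (mul b y) b = b \<and> mul b y = mul y b" if b: "b \<in> H" for b
  proof -
    obtain y where y: "y \<in> S" "mul (mul b y) b = b" "mul (mul b y) y = y" "mul b y = mul y b"
      using times.commuting_inverseE[OF assms(2) HS[OF b]] .
    \<comment> \<open>Since \<open>b\<close> and \<open>b b\<close> both lie in \<open>H\<close>,
      multiplying this related pair by \<open>y\<close> relates \<open>b\<close> to
      \<open>b y\<close>.\<close>
    have "mul (mul b b) y = b"
      using y HS[OF b] by (metis times.assoc)
    then have "(b, mul b y) \<in> ?G"
      using green_H_mul_right[OF related[OF mul_H[OF b b] b] y(1)] by simp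
    then have "mul b y \<in> H"
      using memI b by blast
    moreover from this have "(mul b y, y) \<in> ?G"
      using green_H_mul_right[OF related[OF b] y(1)] y(3) by metis
    ultimately have "y \<in> H"
      using memI by blast
    then show ?thesis
      using y by blast
  qed
  then show ?thesis
    using snr G seminearring.axioms(2)[OF snr]
    unfolding completely_regular_near_ring_def near_ring_def completely_regular_on_def by blast
qed

section \<open>From unions of near-rings back to GLCR\<close>

lemma near_ring_commuting_quasi_inverse:
  assumes "near_ring N add mul" "a \<in> N"
  obtains x where "x \<in> N" "add (add a x) a = a" "add a x = add x a"
    "mul (add a x) a = add a x"
proof -
  interpret seminearring N add mul
    using assms by (simp add: near_ring_def)
  obtain z where G: "group \<lparr>carrier = N, mult = add, one = z\<rparr>" (is "group ?G")
    using assms unfolding near_ring_def by blast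
  then interpret group ?G .
  have z: "z \<in> N"
    using one_closed by simp
  \<comment> \<open>Distributing \<open>(z + z) a\<close> makes \<open>z a\<close> an additive
    idempotent, and the only idempotent of a group is its identity.\<close>
  have "add (mul z a) (mul z a) = mul z a"
    using right_distrib[OF z z assms(2)] l_one[of z] z by simp
  then have "mul z a = z"
    using r_cancel_one[of "mul z a" "mul z a"] times.closed[OF z assms(2)] by simp
  \<comment> \<open>With the additive inverse of \<open>a\<close> as \<open>x\<close>, the sum
    \<open>a + x\<close> is \<open>z\<close>, so the GLCR equation becomes
    \<open>z a = z\<close>.\<close>
  then show thesis
    using that[of "inv\<^bsub>?G\<^esub> a"] assms(2) inv_closed[of a] l_inv[of a] r_inv[of a] l_one[of a]
    by simp
qed

text \<open>Both conditions concern one element at a time, so a witness from the near-ring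
  containing \<open>a\<close> serves in \<open>S\<close>.\<close>

lemma union_of_completely_regular_near_rings:
  assumes "seminearring S add mul" "\<Union>F = S"
    and F: "\<And>N. N \<in> F \<Longrightarrow> completely_regular_near_ring N add mul"
  shows "GLCR S add mul" "completely_regular_on S mul"
proof -
  have "\<exists>x\<in>S. add (add a x) a = a \<and> add a x = add x a \<and> mul (add a x) a = add a x"
    and "\<exists>x\<in>S. mul (mul a x) a = a \<and> mul a x = mul x a" if a: "a \<in> S" for a
  proof -
    obtain N where N: "N \<in> F" "a \<in> N"
      using a assms(2) by blast
    then have NS: "N \<subseteq> S"
      using assms(2) by blast
    show "\<exists>x\<in>S. add (add a x) a = a \<and> add a x = add x a \<and> mul (add a x) a = add a x"
      using near_ring_commuting_quasi_inverse[of N add mul a] F[OF N(1)] N NS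
      unfolding completely_regular_near_ring_def by (metis subsetD)
    show "\<exists>x\<in>S. mul (mul a x) a = a \<and> mul a x = mul x a"
      using F[OF N(1)] N NS
      unfolding completely_regular_near_ring_def completely_regular_on_def by (meson subsetD)
  qed
  then show "GLCR S add mul" "completely_regular_on S mul"
    using assms(1) seminearring.axioms(1,2)[OF assms(1)]
    unfolding GLCR_def completely_regular_on_def by blast+
qed

theorem theorem2p12:
  fixes S :: "'a set"
    and add :: "'a \<Rightarrow> 'a \<Rightarrow> 'a"
    and mul :: "'a \<Rightarrow> 'a \<Rightarrow> 'a"
  assumes "seminearring S add mul"
  shows "((GLCR S add mul \<and> completely_regular_on S mul) \<longleftrightarrow>
            (\<forall>H \<in> S // green_H S add. completely_regular_near_ring H add mul))
       \<and> ((\<forall>H \<in> S // green_H S add. completely_regular_near_ring H add mul) \<longleftrightarrow>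
            (\<exists>F. disjoint F \<and> \<Union>F = S \<and> (\<forall>N\<in>F. completely_regular_near_ring N add mul)))"
proof -
  let ?Q = "S // green_H S add"
  let ?P = "\<lambda>N. completely_regular_near_ring N add mul"
  have equiv: "equiv S (green_H S add)"
    using semigroup_on.equiv_green_H[OF seminearring.axioms(1)[OF assms]] .
  have "disjoint ?Q"
    unfolding disjoint_def using quotient_disj[OF equiv] by blast
  \<comment> \<open>The H-classes themselves form the required family; the three implications then
    close a cycle.\<close>
  then have "\<exists>F. disjoint F \<and> \<Union>F = S \<and> (\<forall>N\<in>F. ?P N)" if "\<forall>H\<in>?Q. ?P H"
    using that Union_quotient[OF equiv] by blast
  moreover have "GLCR S add mul \<and> completely_regular_on S mul"
    if "\<exists>F. disjoint F \<and> \<Union>F = S \<and> (\<forall>N\<in>F. ?P N)"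
    using that union_of_completely_regular_near_rings[OF assms] by blast
  moreover have "\<forall>H\<in>?Q. ?P H" if "GLCR S add mul \<and> completely_regular_on S mul"
    using that GLCR_imp_H_class_completely_regular_near_ring by blast
  ultimately show ?thesis
    by argo
qed

end
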